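(* Let $a,b\in\mathbb{Z}_{>0}$ with $a<b$, and let $x\in\mathbb{Q}$ with $0\le x\le 1$. Then $\mathcal{L}([\phi_{a,b}(G(x))])=L(x,1)$.
   Context: For an irrational real number $\alpha$, its Lagrange constant is $\mathcal{L}(\alpha)=\limsup_{q\to\infty}\frac{1}{q\,\Vert q\alpha\Vert}$, where $q$ ranges over positive integers and $\Vert t\Vert$ denotes the distance from $t$ to the nearest integer. For a rational number $x$ with $0\le x\le 1$ and $n\in\mathbb{Z}$, put $G(x,n)=\lfloor nx\rfloor-\lfloor (n-1)x\rfloor\in\{0,1\}$, and let $G(x)=G(x,1)G(x,2)G(x,3)\cdots$, a right-infinite word over $\{0,1\}$. $\phi_{a,b}$ is the substitution $0\mapsto aa$, $1\mapsto bb$, applied letter by letter to words over $\{0,1\}$ (the images being concatenated). For a right-infinite word $w=w_1w_2\cdots$ of positive integers, $[w]=[0;w_1,w_2,\ldots]$ denotes the value of the regular continued fraction with these partial quotients. Write $[\phi_{a,b}(G(x))]=[0;a_1,a_2,\ldots]$. The purely periodic sequence $(a_i)_{i\ge1}$ is extended periodically to a doubly infinite sequence $(a_i)_{i\in\mathbb{Z}}$; that is, for each $n\in\mathbb{Z}$, $a_{2n-1}=a_{2n}=a$ if $G(x,n)=0$, and $a_{2n-1}=a_{2n}=b$ if $G(x,n)=1$. For $n\in\mathbb{Z}$ define $$L(x,n)=[0;a_{n-2},a_{n-3},\ldots]+a_{n-1}+[0;a_n,a_{n+1},\ldots].$$ In particular $L(x,1)=[0;a_{-1},a_{-2},\ldots]+a_0+[0;a_1,a_2,\ldots]$.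 *)

theory Defs
  imports "HOL-Analysis.Analysis" "HOL-Library.Stream"
begin

definition dist_nearest_int :: "real \<Rightarrow> real" where
  "dist_nearest_int t = \<bar>t - of_int (round t)\<bar>"

text \<open>
  The value is an extended real, as the constant of an irrational number may be infinite.
  The single index \<open>q = 0\<close> does not influence the limit superior. The division is the one on
  \<^typ>\<open>ereal\<close>, where \<open>1 / 0 = \<infinity>\<close>, so every rational argument gets the value \<open>\<infinity>\<close>.
\<close>
definition lagrange_const :: "real \<Rightarrow> ereal" where
  "lagrange_const \<alpha> =
     limsup (\<lambda>q::nat. 1 / ereal (real q * dist_nearest_int (real q * \<alpha>)))"

text \<open>\<open>cf_trunc n w\<close> is the finite continued fraction \<open>[0; w\<^sub>1, \<dots>, w\<^sub>n]\<close>.\<close>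
primrec cf_trunc :: "nat \<Rightarrow> nat stream \<Rightarrow> real" where
  "cf_trunc 0 w = 0"
| "cf_trunc (Suc n) w = 1 / (real (shd w) + cf_trunc n (stl w))"

definition cf_value :: "nat stream \<Rightarrow> real" where
  "cf_value w = lim (\<lambda>n. cf_trunc n w)"

definition G :: "rat \<Rightarrow> int \<Rightarrow> int" where
  "G x n = \<lfloor>of_int n * x\<rfloor> - \<lfloor>of_int (n - 1) * x\<rfloor>"

lemma G_cases:
  assumes "0 \<le> x" "x \<le> 1"
  shows "G x n = 0 \<or> G x n = 1"
proof -
  have "of_int n * x = of_int (n - 1) * x + x"
    by (simp add: algebra_simps)
  then show ?thesis
    using assms unfolding G_def by linarith
qed

definition G_word :: "rat \<Rightarrow> int stream" where
  "G_word x = smap (\<lambda>n. G x (int n)) (fromN 1)"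

definition phi_letter :: "nat \<Rightarrow> nat \<Rightarrow> int \<Rightarrow> nat list" where
  "phi_letter a b c = (if c = 0 then [a, a] else [b, b])"

definition phi :: "nat \<Rightarrow> nat \<Rightarrow> int stream \<Rightarrow> nat stream" where
  "phi a b w = flat (smap (phi_letter a b) w)"

text \<open>The indices \<open>2 * n - 1\<close> and \<open>2 * n\<close> are exactly the \<open>i\<close> with \<open>(i + 1) div 2 = n\<close>.\<close>
definition two_sided :: "nat \<Rightarrow> nat \<Rightarrow> rat \<Rightarrow> int \<Rightarrow> nat" where
  "two_sided a b x i = (if G x ((i + 1) div 2) = 0 then a else b)"

lemma two_sided_odd_even:
  "two_sided a b x (2 * n - 1) = (if G x n = 0 then a else b)"
  "two_sided a b x (2 * n) = (if G x n = 0 then a else b)"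
  by (simp_all add: two_sided_def)

definition L :: "nat \<Rightarrow> nat \<Rightarrow> rat \<Rightarrow> int \<Rightarrow> real" where
  "L a b x n =
     cf_value (smap (\<lambda>k. two_sided a b x (n - 2 - int k)) nats)
     + real (two_sided a b x (n - 1))
     + cf_value (smap (\<lambda>k. two_sided a b x (n + int k)) nats)"

lemma phi_eq_two_sided:
  "phi a b (G_word x) = smap (\<lambda>k. two_sided a b x (1 + int k)) nats"
proof -
  have "flat (smap (phi_letter a b) (smap (\<lambda>n. G x (int n)) (fromN (Suc m)))) !! k
      = two_sided a b x (2 * int m + 1 + int k)" for k m
  proof (induction k arbitrary: m rule: less_induct)
    case (less k)
    let ?w = "\<lambda>m. flat (smap (phi_letter a b) (smap (\<lambda>n. G x (int n)) (fromN (Suc m))))"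
    let ?c = "if G x (int (Suc m)) = 0 then a else b"
    have unf: "?w m = ?c ## ?c ## ?w (Suc m)"
      by (subst siterate.code) (simp add: phi_letter_def)
    have "two_sided a b x (2 * int m + 1) = ?c" "two_sided a b x (2 * int m + 1 + 1) = ?c"
      using two_sided_odd_even[of a b x "int m + 1"] by (simp_all add: algebra_simps)
    moreover have "k = 0 \<or> k = 1 \<or> (\<exists>j. k = Suc (Suc j))"
      by presburger
    ultimately show ?case
      using less.IH[of "k - 2" "Suc m"] unf by (auto simp: algebra_simps)
  qed
  from this[of 0] show ?thesis
    by (intro sym[OF smap_alt[THEN iffD2]]) (simp add: phi_def G_word_def)
qed

end

theory Submission
  imports Defs
begin

text \<open>
  Two facts combine. The first is Perron's formula (\<open>lagrange_const_cfrac\<close>): the Lagrange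
  constant of \<open>[0; f\<^sub>0, f\<^sub>1, \<dots>]\<close> is the limit superior over \<open>n\<close> of
  \<open>f\<^sub>n + [0; f\<^sub>n\<^sub>+\<^sub>1, f\<^sub>n\<^sub>+\<^sub>2, \<dots>] + [0; f\<^sub>n\<^sub>-\<^sub>1, \<dots>, f\<^sub>0]\<close>.
  For \<open>n \<ge> 1\<close> the term of index \<open>n\<close> is \<open>1 / (q \<parallel>q\<alpha>\<parallel>)\<close> at the denominator \<open>q\<close> of the \<open>n\<close>-th
  convergent, and the law of best approximation shows that no integer from this denominator on
  and below the next one gives a larger value.
  When \<open>f\<close> is the right half of the two-sided sequence, the term differs from \<open>L(x, n + 2)\<close>
  only by truncating the left expansion, which costs at most a geometrically small amount.

  The second fact is \<open>L(x, m) \<le> L(x, 1)\<close> for every \<open>m\<close> (\<open>L_le_L_1\<close>). Each \<open>L(x, m)\<close> has the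
  form \<open>c + 1 / (c + U) + V\<close>: \<open>c\<close> is the letter of a block, and \<open>U\<close> and \<open>V\<close> are the values of the
  doubled words read away from that block, in the two opposite directions. Since every block
  has even length, the value of a doubled word is decreasing in the lexicographic order of the
  underlying 0-1 word (\<open>doubled_cf_antimono\<close>). Superadditivity of \<open>k \<mapsto> \<lfloor>kx\<rfloor>\<close> shows that, among all
  words read in either direction from some block, the one read rightwards from \<open>1\<close> is the
  smallest; and among the words read away from a letter equal to the letter at \<open>0\<close>, the one
  read leftwards from \<open>-1\<close> is the largest. So at block \<open>0\<close> both \<open>V\<close> and \<open>1 / (c + U)\<close> are as large as
  possible at once. A block with a different letter has \<open>c = a\<close> against \<open>b \<ge> a + 1\<close>, and there
  \<open>1 / (c + U) \<le> 1\<close> makes up for no more than that difference.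

  Rationality of \<open>x\<close> makes the two-sided sequence periodic, so the value \<open>L(x, 1)\<close> recurs
  infinitely often to the right and the limit superior attains the upper bound.
\<close>

section \<open>Continued fractions with a real tail\<close>

text \<open>
  This is \<open>[0; f\<^sub>0, \<dots>, f\<^sub>n\<^sub>-\<^sub>1 + t]\<close>, read as \<open>t\<close> when \<open>n = 0\<close>. Keeping the tail
  \<open>t\<close> as a real argument lets one function serve for the truncations (\<open>t = 0\<close>) and for splitting an infinite expansion after \<open>n\<close> quotients.
\<close>
primrec cf_tail :: "nat \<Rightarrow> (nat \<Rightarrow> nat) \<Rightarrow> real \<Rightarrow> real" where
  "cf_tail 0 f t = t"
| "cf_tail (Suc n) f t = 1 / (real (f 0) + cf_tail n (\<lambda>k. f (Suc k)) t)"

abbreviation cfrac :: "(nat \<Rightarrow> nat) \<Rightarrow> real" where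
  "cfrac f \<equiv> cf_value (smap f nats)"

lemma cf_trunc_eq_cf_tail: "cf_trunc n (smap f nats) = cf_tail n f 0"
proof (induction n arbitrary: f)
  case (Suc n)
  have "stl (smap f nats) = smap (\<lambda>k. f (Suc k)) nats"
    by (intro sym[OF smap_alt[THEN iffD2]]) (simp flip: snth.simps)
  with Suc show ?case by simp
qed simp

lemma cf_tail_cong:
  assumes "\<And>k. k < n \<Longrightarrow> f k = g k"
  shows "cf_tail n f t = cf_tail n g t"
  using assms
proof (induction n arbitrary: f g)
  case (Suc n)
  have "cf_tail n (\<lambda>k. f (Suc k)) t = cf_tail n (\<lambda>k. g (Suc k)) t"
    by (rule Suc.IH) (rule Suc.prems, simp)
  with Suc.prems[of 0] show ?case by simp
qed simp

lemma cf_tail_add: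
  "cf_tail (m + n) f t = cf_tail m f (cf_tail n (\<lambda>k. f (m + k)) t)"
  by (induction m arbitrary: f) auto

lemma cf_tail_bounds:
  assumes "\<And>k. 0 < f k" "0 \<le> t" "t \<le> 1"
  shows "0 \<le> cf_tail n f t" "cf_tail n f t \<le> 1"
proof -
  have "0 \<le> cf_tail n f t \<and> cf_tail n f t \<le> 1"
    using assms
  proof (induction n arbitrary: f)
    case (Suc n)
    have "1 \<le> real (f 0)" using Suc.prems(1)[of 0] by linarith
    with Suc.IH[of "\<lambda>k. f (Suc k)"] Suc.prems show ?case
      by (auto simp: divide_simps)
  qed simp
  then show "0 \<le> cf_tail n f t" "cf_tail n f t \<le> 1" by auto
qed

text \<open>
  Two quotients at a time, the dependence on the tail is increasing and contracting: both
  follow from this quotient, whose denominator is at least 4.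
\<close>

lemma two_step_diff:
  fixes c d s t :: real
  assumes "1 \<le> c" "1 \<le> d" "0 \<le> s" "0 \<le> t"
  shows "1 / (c + 1 / (d + t)) - 1 / (c + 1 / (d + s))
           = (t - s) / ((c * (d + t) + 1) * (c * (d + s) + 1))"
proof -
  have eq: "1 / (c + 1 / (d + u)) = (d + u) / (c * (d + u) + 1)" if "0 \<le> u" for u
    using assms that by (simp add: field_simps)
  have pos: "0 < c * (d + u) + 1" if "0 \<le> u" for u
    using assms that by (simp add: add_nonneg_pos)
  have "(d + t) * (c * (d + s) + 1) - (d + s) * (c * (d + t) + 1) = t - s"
    by (simp add: algebra_simps)
  then show ?thesis
    using eq[of s] eq[of t] pos[of s] pos[of t] assms
    by (simp add: diff_frac_eq)
qed

lemma two_step_denominator: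
  fixes c d s t :: real
  assumes "1 \<le> c" "1 \<le> d" "0 \<le> s" "0 \<le> t"
  shows "4 \<le> (c * (d + t) + 1) * (c * (d + s) + 1)"
proof -
  have ge1: "1 \<le> c * (d + u)" if "0 \<le> u" for u
    using assms that mult_mono[of 1 c 1 "d + u"] by auto
  have "2 * 2 \<le> (c * (d + t) + 1) * (c * (d + s) + 1)"
    using assms by (intro mult_mono) (use ge1[of s] ge1[of t] in auto)
  then show ?thesis by simp
qed

lemma cf_tail_even_mono:
  assumes "\<And>k. 0 < f k" "0 \<le> s" "s \<le> t" "t \<le> 1"
  shows "cf_tail (2 * n) f s \<le> cf_tail (2 * n) f t"
  using assms
proof (induction n arbitrary: f)
  case (Suc n)
  let ?g = "\<lambda>k. f (Suc (Suc k))"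
  let ?s = "cf_tail (2 * n) ?g s" and ?t = "cf_tail (2 * n) ?g t"
  have cd: "1 \<le> real (f 0)" "1 \<le> real (f 1)"
    using Suc.prems(1)[of 0] Suc.prems(1)[of 1] by linarith+
  have nn: "0 \<le> ?s" "0 \<le> ?t"
    using cf_tail_bounds[of ?g] Suc.prems by auto
  have "0 \<le> (?t - ?s) / ((real (f 0) * (real (f 1) + ?t) + 1) * (real (f 0) * (real (f 1) + ?s) + 1))"
    using two_step_denominator[OF cd nn] Suc.IH[of ?g] Suc.prems
    by (intro divide_nonneg_nonneg) auto
  with two_step_diff[OF cd nn] show ?case by simp
qed simp

lemma cf_tail_contraction:
  assumes "\<And>k. 0 < f k" "0 \<le> s" "s \<le> 1" "0 \<le> t" "t \<le> 1"
  shows "\<bar>cf_tail n f t - cf_tail n f s\<bar> \<le> (1/4) ^ (n div 2)"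
  using assms
proof (induction n arbitrary: f rule: less_induct)
  case (less n)
  show ?case
  proof (cases "n < 2")
    case True
    then show ?thesis
      using cf_tail_bounds[of f t n] cf_tail_bounds[of f s n] less.prems by simp
  next
    case False
    then obtain m where n: "n = Suc (Suc m)"
      by (metis less_2_cases_iff not0_implies_Suc One_nat_def)
    let ?g = "\<lambda>k. f (Suc (Suc k))"
    let ?s = "cf_tail m ?g s" and ?t = "cf_tail m ?g t"
    define D where "D = (real (f 0) * (real (f 1) + ?t) + 1) * (real (f 0) * (real (f 1) + ?s) + 1)"
    have cd: "1 \<le> real (f 0)" "1 \<le> real (f 1)"
      using less.prems(1)[of 0] less.prems(1)[of 1] by linarith+
    have nn: "0 \<le> ?s" "0 \<le> ?t"
      using cf_tail_bounds[of ?g] less.prems by auto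
    have D: "4 \<le> D" unfolding D_def by (rule two_step_denominator[OF cd nn])
    have "cf_tail n f t - cf_tail n f s = (?t - ?s) / D"
      unfolding D_def two_step_diff[OF cd nn, symmetric] by (simp add: n)
    then have "\<bar>cf_tail n f t - cf_tail n f s\<bar> = \<bar>?t - ?s\<bar> / D"
      using D by simp
    also have "\<dots> \<le> \<bar>?t - ?s\<bar> / 4"
      using D by (intro divide_left_mono) auto
    also have "\<dots> \<le> (1/4) ^ (m div 2) / 4"
      using less.IH[of m ?g] less.prems n by (intro divide_right_mono) auto
    finally show ?thesis by (simp add: n)
  qed
qed

lemma quarter_power_tendsto_0: "(\<lambda>n. (1/4::real) ^ (n div 2)) \<longlonglongrightarrow> 0"
proof -
  have "filterlim (\<lambda>n::nat. n div 2) sequentially sequentially"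
    unfolding filterlim_at_top
  proof
    fix Z :: nat
    show "\<forall>\<^sub>F n in sequentially. Z \<le> n div 2"
      using eventually_ge_at_top[of "2 * Z"] by eventually_elim linarith
  qed
  then show ?thesis
    using filterlim_compose[OF LIMSEQ_realpow_zero[of "1/4::real"]] by simp
qed

text \<open>
  Truncations that share their first \<open>N\<close> quotients are evaluations of the same map at two tails
  in the unit interval, so the contraction makes them a Cauchy sequence.
\<close>

lemma cf_tail_tendsto_cfrac:
  assumes "\<And>k. 0 < f k"
  shows "(\<lambda>n. cf_tail n f 0) \<longlonglongrightarrow> cfrac f"
proof -
  have close: "\<bar>cf_tail (N + m) f 0 - cf_tail N f 0\<bar> \<le> (1/4) ^ (N div 2)" for N m
    unfolding cf_tail_add
    using assms cf_tail_bounds[of "\<lambda>k. f (N + k)" 0 m] by (intro cf_tail_contraction) auto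
  have "Cauchy (\<lambda>n. cf_tail n f 0)"
    unfolding Cauchy_altdef2
  proof (intro allI impI)
    fix e :: real assume "0 < e"
    then obtain N where "(1/4::real) ^ (N div 2) < e"
      using order_tendstoD(2)[OF quarter_power_tendsto_0, of e] unfolding eventually_sequentially
      by auto
    then have "dist (cf_tail n f 0) (cf_tail N f 0) < e" if "n \<ge> N" for n
      using close[of N "n - N"] that by (simp add: dist_real_def)
    then show "\<exists>N. \<forall>n\<ge>N. dist (cf_tail n f 0) (cf_tail N f 0) < e" by blast
  qed
  then have "convergent (\<lambda>n. cf_tail n f 0)"
    by (simp add: Cauchy_convergent_iff)
  then show ?thesis
    by (simp add: cf_value_def cf_trunc_eq_cf_tail convergent_LIMSEQ_iff)
qed

lemma cfrac_bounds:
  assumes "\<And>k. 0 < f k"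
  shows "0 \<le> cfrac f" "cfrac f \<le> 1"
proof -
  show "0 \<le> cfrac f"
    by (rule LIMSEQ_le_const[OF cf_tail_tendsto_cfrac]) (use assms cf_tail_bounds in auto)
  show "cfrac f \<le> 1"
    by (rule LIMSEQ_le_const2[OF cf_tail_tendsto_cfrac]) (use assms cf_tail_bounds in auto)
qed

lemma cfrac_unfold:
  assumes "\<And>k. 0 < f k"
  shows "cfrac f = 1 / (real (f 0) + cfrac (\<lambda>k. f (Suc k)))"
proof (rule LIMSEQ_unique)
  show "(\<lambda>n. cf_tail (Suc n) f 0) \<longlonglongrightarrow> cfrac f"
    using cf_tail_tendsto_cfrac[OF assms] by (rule LIMSEQ_Suc)
  have "real (f 0) + cfrac (\<lambda>k. f (Suc k)) \<noteq> 0"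
    using assms[of 0] cfrac_bounds(1)[of "\<lambda>k. f (Suc k)"] assms by (simp add: add_pos_nonneg less_imp_neq[symmetric])
  then show "(\<lambda>n. cf_tail (Suc n) f 0) \<longlonglongrightarrow> 1 / (real (f 0) + cfrac (\<lambda>k. f (Suc k)))"
    by (auto intro!: tendsto_intros cf_tail_tendsto_cfrac assms)
qed

lemma cfrac_pos:
  assumes "\<And>k. 0 < f k"
  shows "0 < cfrac f"
proof -
  have "0 < real (f 0) + cfrac (\<lambda>k. f (Suc k))"
    using assms[of 0] cfrac_bounds(1)[of "\<lambda>k. f (Suc k)"] assms by (simp add: add_pos_nonneg)
  then show ?thesis
    by (subst cfrac_unfold) (use assms in auto)
qed

lemma cfrac_eq_cf_tail:
  assumes "\<And>k. 0 < f k"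
  shows "cfrac f = cf_tail n f (cfrac (\<lambda>k. f (n + k)))"
  using assms
proof (induction n arbitrary: f)
  case (Suc n)
  have "cfrac (\<lambda>k. f (Suc k)) = cf_tail n (\<lambda>k. f (Suc k)) (cfrac (\<lambda>k. f (Suc (n + k))))"
    by (rule Suc.IH) (rule Suc.prems)
  then show ?case
    unfolding cf_tail.simps add_Suc by (rule subst) (rule cfrac_unfold[OF Suc.prems])
qed simp

lemma cfrac_approx:
  assumes "\<And>k. 0 < f k"
  shows "\<bar>cf_tail n f 0 - cfrac f\<bar> \<le> (1/4) ^ (n div 2)"
proof -
  have "0 \<le> cfrac (\<lambda>k. f (n + k))" "cfrac (\<lambda>k. f (n + k)) \<le> 1"
    by (rule cfrac_bounds, rule assms)+
  then have "\<bar>cf_tail n f 0 - cf_tail n f (cfrac (\<lambda>k. f (n + k)))\<bar> \<le> (1/4) ^ (n div 2)"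
    by (rule cf_tail_contraction[of f, OF assms]) simp_all
  moreover have "cfrac f = cf_tail n f (cfrac (\<lambda>k. f (n + k)))"
    by (rule cfrac_eq_cf_tail) (rule assms)
  ultimately show ?thesis by linarith
qed

section \<open>Convergents\<close>

text \<open>
  Both numerators and denominators of convergents satisfy this recurrence; they differ in the
  initial values \<open>u\<close>, \<open>v\<close>. The indices are shifted by one against the usual ones so that the
  conventional values of index \<open>-1\<close> sit at 0: the \<open>n\<close>-th convergent has index \<open>Suc n\<close>.
\<close>

fun continuant :: "(nat \<Rightarrow> nat) \<Rightarrow> int \<Rightarrow> int \<Rightarrow> nat \<Rightarrow> int" where
  "continuant f u v 0 = u"
| "continuant f u v (Suc 0) = v"
| "continuant f u v (Suc (Suc n)) = int (f n) * continuant f u v (Suc n) + continuant f u v n"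

abbreviation "cf_num f \<equiv> continuant f 1 0"
abbreviation "cf_den f \<equiv> continuant f 0 1"

lemma cf_den_nonneg: "0 \<le> cf_den f n"
  by (induction f "0::int" "1::int" n rule: continuant.induct) auto

lemma cf_den_pos:
  assumes "\<And>k. 0 < f k"
  shows "0 < cf_den f (Suc n)"
proof (induction n)
  case (Suc n)
  then show ?case
    using assms[of n] cf_den_nonneg[of f n] by (simp add: add_pos_nonneg)
qed simp

lemma cf_den_strict_mono:
  assumes "\<And>k. 0 < f k"
  shows "cf_den f (Suc (Suc n)) < cf_den f (Suc (Suc (Suc n)))"
proof -
  have "1 * cf_den f (Suc (Suc n)) \<le> int (f (Suc n)) * cf_den f (Suc (Suc n))"
    using assms[of "Suc n"] cf_den_nonneg by (intro mult_right_mono) auto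
  then show ?thesis
    using cf_den_pos[of f n, OF assms] by simp
qed

lemma cf_determinant:
  "cf_num f n * cf_den f (Suc n) - cf_num f (Suc n) * cf_den f n = (-1) ^ n"
  by (induction n) (auto simp: algebra_simps)

lemma cf_tail_Suc_right: "cf_tail (Suc n) f t = cf_tail n f (1 / (real (f n) + t))"
  using cf_tail_add[of n 1 f t] by simp

lemma cf_tail_moebius:
  fixes t :: real
  assumes "\<And>k. 0 < f k" "0 \<le> t"
  shows "cf_tail n f t
     = (cf_num f (Suc n) + t * cf_num f n) / (cf_den f (Suc n) + t * cf_den f n)"
  using assms(2)
proof (induction n arbitrary: t)
  case (Suc n)
  let ?c = "real (f n) + t"
  have c: "0 < ?c" using assms(1)[of n] Suc.prems by simp
  have "cf_tail (Suc n) f t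
      = (cf_num f (Suc n) + 1 / ?c * cf_num f n) / (cf_den f (Suc n) + 1 / ?c * cf_den f n)"
    unfolding cf_tail_Suc_right using Suc.IH[of "1 / ?c"] c by simp
  also have "\<dots> = (?c * (cf_num f (Suc n) + 1 / ?c * cf_num f n))
      / (?c * (cf_den f (Suc n) + 1 / ?c * cf_den f n))"
    using c by (subst mult_divide_mult_cancel_left) auto
  also have "\<dots> = (?c * cf_num f (Suc n) + cf_num f n) / (?c * cf_den f (Suc n) + cf_den f n)"
    using c by (simp only: distrib_left) simp
  finally show ?case by (simp add: algebra_simps)
qed simp

text \<open>
  Dividing the recurrence for the denominators by its middle term produces the reversed word
  one quotient at a time.
\<close>

lemma cf_den_ratio:
  assumes "\<And>k. 0 < f k"
  shows "cf_den f n / cf_den f (Suc n) = cf_tail n (\<lambda>k. f (n - Suc k)) 0"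
proof (induction n)
  case (Suc n)
  let ?q = "real_of_int (cf_den f (Suc n))"
  have q: "0 < ?q" using cf_den_pos[of f n, OF assms] by simp
  have "cf_den f (Suc n) / cf_den f (Suc (Suc n)) = ?q / (f n * ?q + cf_den f n)"
    by simp
  also have "\<dots> = 1 / (f n + cf_den f n / ?q)"
    using q by (simp add: field_simps)
  finally show ?case using Suc.IH by simp
qed simp

definition cf_error :: "(nat \<Rightarrow> nat) \<Rightarrow> nat \<Rightarrow> real" where
  "cf_error f n = cf_den f n * cfrac f - cf_num f n"

text \<open>
  Write the number as the Moebius image of its tail \<open>t n\<close> and clear denominators: only the
  determinant \<open>(-1) ^ n\<close> survives in the numerator.
\<close>

lemma cf_error_eq:
  fixes t :: "nat \<Rightarrow> real"
  assumes "\<And>k. 0 < f k"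
  defines "t \<equiv> \<lambda>n. cfrac (\<lambda>k. f (n + k))"
  shows "cf_error f (Suc n) = (-1) ^ n * t n / (cf_den f (Suc n) + t n * cf_den f n)"
proof -
  let ?t = "t n"
  let ?q = "cf_den f (Suc n) + ?t * cf_den f n"
  have t: "0 \<le> ?t" unfolding t_def using assms(1) by (intro cfrac_bounds)
  have q: "0 < ?q"
    using cf_den_pos[of f n, OF assms(1)] cf_den_nonneg[of f n] t by (simp add: add_pos_nonneg)
  have "cfrac f = (cf_num f (Suc n) + ?t * cf_num f n) / ?q"
    using cfrac_eq_cf_tail[of f n, OF assms(1)] cf_tail_moebius[of f "t n" n, OF assms(1) t]
    by (simp add: t_def)
  then have scaled: "cfrac f * ?q = cf_num f (Suc n) + ?t * cf_num f n"
    using q by simp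
  have "cf_error f (Suc n) * ?q = cf_den f (Suc n) * (cfrac f * ?q) - cf_num f (Suc n) * ?q"
    by (simp add: cf_error_def algebra_simps)
  also have "\<dots> = ?t * real_of_int (cf_num f n * cf_den f (Suc n) - cf_num f (Suc n) * cf_den f n)"
    unfolding scaled by (simp add: algebra_simps)
  also have "\<dots> = (-1) ^ n * ?t"
    unfolding cf_determinant by simp
  finally show ?thesis using q by (simp add: field_simps)
qed

lemma cf_error_nonzero:
  assumes "\<And>k. 0 < f k"
  shows "cf_error f (Suc n) \<noteq> 0"
proof -
  have t: "0 < cfrac (\<lambda>k. f (n + k))" by (intro cfrac_pos assms)
  then have "0 < cf_den f (Suc n) + cfrac (\<lambda>k. f (n + k)) * cf_den f n"
    using cf_den_pos[of f n, OF assms] cf_den_nonneg[of f n] by (simp add: add_pos_nonneg)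
  with t show ?thesis by (simp add: cf_error_eq[of f, OF assms])
qed

text \<open>
  By the formula for the error, the left side is \<open>1 / t + Q\<^sub>n / Q\<^sub>n\<^sub>+\<^sub>1\<close> with \<open>t\<close> the tail from \<open>n\<close>;
  unfolding \<open>t\<close> once gives the first two summands and reversing the word gives the third.
\<close>

lemma perron_identity:
  assumes "\<And>k. 0 < f k"
  shows "1 / (cf_den f (Suc n) * \<bar>cf_error f (Suc n)\<bar>)
     = real (f n) + cfrac (\<lambda>k. f (Suc n + k)) + cf_tail n (\<lambda>k. f (n - Suc k)) 0"
proof -
  let ?t = "cfrac (\<lambda>k. f (n + k))" and ?q = "real_of_int (cf_den f (Suc n))"
  have t: "0 < ?t" by (intro cfrac_pos assms)
  have q: "0 < ?q" using cf_den_pos[of f n, OF assms] by simp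
  have s: "0 < ?q + ?t * cf_den f n"
    using q t cf_den_nonneg[of f n] by (simp add: add_pos_nonneg)
  have abs_error: "\<bar>cf_error f (Suc n)\<bar> = ?t / (?q + ?t * cf_den f n)"
    using s t by (simp add: cf_error_eq[of f, OF assms] abs_mult power_abs)
  have "1 / (?q * \<bar>cf_error f (Suc n)\<bar>) = (?q + ?t * cf_den f n) / (?q * ?t)"
    unfolding abs_error by simp
  also have "\<dots> = 1 / ?t + cf_den f n / ?q"
    using t q by (simp add: add_divide_distrib)
  also have "1 / ?t = f n + cfrac (\<lambda>k. f (Suc n + k))"
    by (subst cfrac_unfold) (simp_all add: assms)
  finally show ?thesis by (simp add: cf_den_ratio[of f, OF assms])
qed

lemma cf_error_alternates:
  assumes "\<And>k. 0 < f k"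
  shows "cf_error f (Suc n) * cf_error f (Suc (Suc n)) \<le> 0"
proof -
  define t where "t = (\<lambda>n. cfrac (\<lambda>k. f (n + k)))"
  define r where "r n = t n / (cf_den f (Suc n) + t n * cf_den f n)" for n
  have t: "0 \<le> t n" for n unfolding t_def by (intro cfrac_bounds assms)
  have r: "0 \<le> r n" for n
    unfolding r_def using t[of n] cf_den_nonneg[of f] by simp
  have "cf_error f (Suc n) = (-1) ^ n * r n" for n
    using cf_error_eq[of f n] assms by (simp add: t_def r_def)
  then have "cf_error f (Suc n) * cf_error f (Suc (Suc n))
      = - (((-1) ^ n * (-1) ^ n) * (r n * r (Suc n)))"
    by simp
  then show ?thesis using r[of n] r[of "Suc n"] by (simp flip: power_add)
qed

section \<open>Best approximation and the Lagrange constant\<close>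

text \<open>
  Consecutive convergents form a basis of the integer lattice, so \<open>(q, p)\<close> is an integer
  combination of them with coefficients \<open>u\<close>, \<open>v\<close>. As \<open>q\<close> lies strictly between 0 and the second
  denominator, \<open>u\<close> is nonzero and \<open>v\<close> does not have the same sign as \<open>u\<close>. Consecutive errors have
  opposite signs too, so the two contributions to \<open>q \<alpha> - p\<close> reinforce each other, and the first
  alone has at least the size of one error.
\<close>

lemma best_approximation:
  fixes p q :: int
  assumes pos: "\<And>k. 0 < f k" and q: "0 < q" "q < cf_den f (Suc (Suc n))"
  shows "\<bar>cf_error f (Suc n)\<bar> \<le> \<bar>q * cfrac f - p\<bar>"
proof -
  define P where "P = cf_num f (Suc n)"
  define P' where "P' = cf_num f (Suc (Suc n))"
  define Q where "Q = cf_den f (Suc n)"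
  define Q' where "Q' = cf_den f (Suc (Suc n))"
  define d where "d = P * Q' - P' * Q"
  define u where "u = d * (p * Q' - q * P')"
  define v where "v = - d * (p * Q - q * P)"
  have d: "d * d = 1"
    using cf_determinant[of f "Suc n"] by (simp add: d_def P_def P'_def Q_def Q'_def flip: power_add)
  \<comment> \<open>\<open>u\<close> and \<open>v\<close> come from Cramer's rule; the determinant \<open>d\<close> is its own inverse.\<close>
  have "u * Q + v * Q' = (d * d) * q" "u * P + v * P' = (d * d) * p"
    by (simp_all add: u_def v_def d_def algebra_simps)
  then have uv: "q = u * Q + v * Q'" "p = u * P + v * P'" by (simp_all add: d)
  have Qpos: "0 < Q" "0 < Q'" unfolding Q_def Q'_def by (intro cf_den_pos pos)+
  have small: "\<not> Q' \<le> q" using q(2) by (simp add: Q'_def)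
  have "u \<noteq> 0"
  proof
    assume "u = 0"
    then have "0 < v" using uv(1) q(1) Qpos by (simp add: zero_less_mult_iff)
    then have "Q' \<le> q" using \<open>u = 0\<close> uv(1) Qpos by simp
    with small show False ..
  qed
  have opposite: "u * v \<le> 0"
  proof (rule ccontr)
    assume "\<not> u * v \<le> 0"
    then consider "0 < u" "0 < v" | "u < 0" "v < 0" by (auto simp: not_le zero_less_mult_iff)
    then show False
    proof cases
      case 1
      then have "0 \<le> u * Q" "1 * Q' \<le> v * Q'" using Qpos by (auto intro!: mult_right_mono)
      with small uv(1) show False by simp
    next
      case 2
      then have "u * Q < 0" "v * Q' < 0" using Qpos by (simp_all add: mult_neg_pos)
      with q(1) uv(1) show False by simp
    qed
  qed
  let ?E = "cf_error f (Suc n)" and ?E' = "cf_error f (Suc (Suc n))"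
  have "q * cfrac f - p = u * ?E + v * ?E'"
    unfolding uv by (simp add: cf_error_def P_def P'_def Q_def Q'_def algebra_simps)
  moreover have "0 \<le> (u * ?E) * (v * ?E')"
  proof -
    have "real_of_int (u * v) \<le> 0" using opposite by (simp only: of_int_le_0_iff)
    then have "0 \<le> real_of_int (u * v) * (?E * ?E')"
      using cf_error_alternates[of f n, OF pos] by (rule mult_nonpos_nonpos)
    then show ?thesis by (simp add: mult_ac)
  qed
  ultimately have "\<bar>u * ?E\<bar> \<le> \<bar>q * cfrac f - p\<bar>"
    by (auto simp: zero_le_mult_iff)
  moreover have "1 * \<bar>?E\<bar> \<le> \<bar>real_of_int u\<bar> * \<bar>?E\<bar>"
    using \<open>u \<noteq> 0\<close> by (intro mult_right_mono) auto
  ultimately show ?thesis by (simp add: abs_mult)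
qed

lemma cf_den_mono:
  assumes "\<And>k. 0 < f k" "m \<le> n"
  shows "cf_den f (Suc m) \<le> cf_den f (Suc n)"
  using assms(2)
proof (induction n rule: dec_induct)
  case (step n)
  have "cf_den f (Suc n) \<le> cf_den f (Suc (Suc n))"
    using cf_den_strict_mono[of f, OF assms(1)] assms(1)[of 0] by (cases n) (auto simp: less_imp_le Suc_le_eq)
  with step show ?case by simp
qed simp

lemma cf_den_lower_bound:
  assumes "\<And>k. 0 < f k"
  shows "int n < cf_den f (Suc (Suc n))"
proof (induction n)
  case (Suc n)
  then show ?case using cf_den_strict_mono[of f n, OF assms] by linarith
qed (use assms in simp)

lemma cf_den_bracket:
  fixes q :: int
  assumes pos: "\<And>k. 0 < f k" and q: "cf_den f (Suc N) \<le> q"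
  obtains n where "N \<le> n" "cf_den f (Suc n) \<le> q" "q < cf_den f (Suc (Suc n))"
proof -
  define n where "n = (LEAST n. q < cf_den f (Suc (Suc n)))"
  have "q < cf_den f (Suc (Suc (nat q)))"
    using cf_den_lower_bound[of f "nat q", OF pos] by linarith
  then have upper: "q < cf_den f (Suc (Suc n))"
    unfolding n_def by (rule LeastI)
  have "N \<le> n"
  proof (rule ccontr)
    assume "\<not> N \<le> n"
    then have "cf_den f (Suc (Suc n)) \<le> cf_den f (Suc N)" by (intro cf_den_mono pos) simp
    with q upper show False by simp
  qed
  moreover have "cf_den f (Suc n) \<le> q"
  proof (cases n)
    case 0
    then show ?thesis using cf_den_mono[of f 0 N, OF pos] q by simp
  next
    case (Suc m)
    then show ?thesis using not_less_Least[of m "\<lambda>n. q < cf_den f (Suc (Suc n))"] by (simp add: n_def)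
  qed
  ultimately show ?thesis using that upper by blast
qed

lemma dist_nearest_int_le: "dist_nearest_int t \<le> \<bar>t - of_int p\<bar>"
  unfolding dist_nearest_int_def using round_diff_minimal[of t p] by simp

text \<open>
  Perron's formula. Between two consecutive denominators, \<open>q\<close> is at least the smaller one and
  the distance of \<open>q \<alpha>\<close> to the integers is at least the error there, so the convergent yields
  the largest value; at the denominators of index at least 1 the value is exactly the summand
  on the right by \<open>perron_identity\<close>.
\<close>

lemma lagrange_const_cfrac:
  assumes pos: "\<And>k. 0 < f k"
  shows "lagrange_const (cfrac f) = limsup (\<lambda>n.
     ereal (real (f n) + cfrac (\<lambda>k. f (Suc n + k)) + cf_tail n (\<lambda>k. f (n - Suc k)) 0))"
    (is "_ = limsup ?M")
proof -
  define H where "H q = 1 / ereal (real q * dist_nearest_int (real q * cfrac f))" for q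
  have M: "?M n = ereal (1 / (cf_den f (Suc n) * \<bar>cf_error f (Suc n)\<bar>))" for n
    using perron_identity[of f n, OF pos] by simp
  have Epos: "0 < cf_den f (Suc n) * \<bar>cf_error f (Suc n)\<bar>" for n
    using cf_den_pos[of f n, OF pos] cf_error_nonzero[of f n, OF pos] by simp
  have dist_ge: "\<bar>cf_error f (Suc n)\<bar> \<le> dist_nearest_int (real q * cfrac f)"
    if "0 < q" "int q < cf_den f (Suc (Suc n))" for q n
    unfolding dist_nearest_int_def
    using best_approximation[of f "int q" n, OF pos] that by simp
  have H_le: "H q \<le> ?M n" if q: "cf_den f (Suc n) \<le> int q" "int q < cf_den f (Suc (Suc n))" for q n
  proof -
    have q0: "0 < q" using q(1) cf_den_pos[of f n, OF pos] by linarith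
    have "real_of_int (cf_den f (Suc n)) \<le> real q" using q(1) by linarith
    then have le: "cf_den f (Suc n) * \<bar>cf_error f (Suc n)\<bar> \<le> real q * dist_nearest_int (real q * cfrac f)"
      using dist_ge[OF q0 q(2)] by (intro mult_mono) auto
    have "0 < real q * dist_nearest_int (real q * cfrac f)"
      using le Epos[of n] by linarith
    then have "H q = ereal (1 / (real q * dist_nearest_int (real q * cfrac f)))"
      unfolding H_def one_ereal_def by (subst ereal_divide) (metis less_irrefl)
    then show ?thesis
      unfolding M using le Epos[of n] by (simp add: divide_left_mono)
  qed
  \<comment> \<open>The index starts at 1: if the first quotient is 1, the denominators of the convergents 0 and
    1 coincide, and the nearest integer is then not the numerator of convergent 0.\<close>
  have H_eq: "H (nat (cf_den f (Suc (Suc n)))) = ?M (Suc n)" for n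
  proof -
    let ?q = "nat (cf_den f (Suc (Suc n)))"
    have q: "int ?q = cf_den f (Suc (Suc n))" using cf_den_pos[of f "Suc n", OF pos] by simp
    then have qr: "real ?q = cf_den f (Suc (Suc n))" by linarith
    have "dist_nearest_int (real ?q * cfrac f) = \<bar>cf_error f (Suc (Suc n))\<bar>"
    proof (rule antisym)
      show "dist_nearest_int (real ?q * cfrac f) \<le> \<bar>cf_error f (Suc (Suc n))\<bar>"
        unfolding cf_error_def qr by (rule dist_nearest_int_le)
      show "\<bar>cf_error f (Suc (Suc n))\<bar> \<le> dist_nearest_int (real ?q * cfrac f)"
      proof (rule dist_ge)
        show "0 < ?q" using q cf_den_pos[of f "Suc n", OF pos] by linarith
        show "int ?q < cf_den f (Suc (Suc (Suc n)))" unfolding q by (rule cf_den_strict_mono[of f, OF pos])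
      qed
    qed
    then show ?thesis
      using Epos[of "Suc n"] unfolding H_def M qr one_ereal_def by (subst ereal_divide) auto
  qed
  have "limsup H \<le> limsup ?M"
    unfolding Limsup_le_iff
  proof (intro allI impI)
    fix y assume "limsup ?M < y"
    then have "\<forall>\<^sub>F n in sequentially. ?M n < y" by (rule Limsup_lessD)
    then obtain N where N: "\<And>n. N \<le> n \<Longrightarrow> ?M n < y"
      by (auto simp only: eventually_sequentially)
    show "\<forall>\<^sub>F q in sequentially. H q < y"
      using eventually_ge_at_top[of "nat (cf_den f (Suc N))"]
    proof eventually_elim
      case (elim q)
      then have "cf_den f (Suc N) \<le> int q" by (simp only: nat_le_iff)
      then obtain n where "N \<le> n" "cf_den f (Suc n) \<le> int q" "int q < cf_den f (Suc (Suc n))"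
        by (rule cf_den_bracket[of f, OF pos])
      then show ?case using le_less_trans[OF H_le[of n q] N[of n]] by blast
    qed
  qed
  moreover have "limsup ?M \<le> limsup H"
  proof -
    have "strict_mono (\<lambda>n. nat (cf_den f (Suc (Suc n))))"
      using cf_den_strict_mono[of f, OF pos] cf_den_pos[of f, OF pos]
      by (intro strict_monoI_Suc) (simp only: nat_less_eq_zless cf_den_nonneg)
    from limsup_subseq_mono[OF this, of H] have "limsup (\<lambda>n. ?M (Suc n)) \<le> limsup H"
      by (simp only: o_def H_eq)
    then show ?thesis using limsup_shift[of ?M] by simp
  qed
  ultimately show ?thesis unfolding lagrange_const_def H_def by (rule antisym)
qed

section \<open>Doubled words\<close>

text \<open>
  The value \<open>[\<phi>\<^sub>a\<^sub>,\<^sub>b(g)]\<close>.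
\<close>

definition doubled_cf :: "nat \<Rightarrow> nat \<Rightarrow> (nat \<Rightarrow> int) \<Rightarrow> real" where
  "doubled_cf a b g = cfrac (\<lambda>k. if g (k div 2) = 0 then a else b)"

lemma doubled_cf_bounds:
  assumes "0 < a" "a < b"
  shows "0 \<le> doubled_cf a b g" "doubled_cf a b g \<le> 1"
  unfolding doubled_cf_def by (intro cfrac_bounds; use assms in simp)+

text \<open>
  The hypothesis on the partial sums says that \<open>g\<close> is lexicographically at most \<open>h\<close>, in the form
  in which it is available for words made of differences of floors. At the first difference \<open>g\<close>
  has 0 and \<open>h\<close> has 1, so the remaining expansions begin with \<open>a\<close> and with \<open>b \<ge> a + 1\<close>
  respectively; the common prefix has even length and preserves the order of the tails.
\<close>

lemma doubled_cf_antimono: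
  fixes a b :: nat and g h :: "nat \<Rightarrow> int"
  assumes ab: "0 < a" "a < b"
    and letters: "\<And>k. g k = 0 \<or> g k = 1" "\<And>k. h k = 0 \<or> h k = 1"
    and sums: "\<And>k. (\<Sum>i<k. g i) \<le> (\<Sum>i<k. h i)"
  shows "doubled_cf a b h \<le> doubled_cf a b g"
proof (cases "g = h")
  case False
  define letter where "letter c = (if c = 0 then a else b)" for c :: int
  define k where "k = (LEAST k. g k \<noteq> h k)"
  have ne: "g k \<noteq> h k" unfolding k_def by (rule LeastI_ex) (use False in auto)
  have eq: "g i = h i" if "i < k" for i using not_less_Least[of i] that by (auto simp: k_def)
  have "(\<Sum>i<k. g i) = (\<Sum>i<k. h i)" by (intro sum.cong) (auto simp: eq)
  with sums[of "Suc k"] have "g k \<le> h k" by simp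
  with ne letters[of k] have gh: "g k = 0" "h k = 1" by auto
  let ?f = "\<lambda>g k. letter (g (k div 2))"
  let ?V = "\<lambda>g. cfrac (\<lambda>i. letter (g ((2 * k + i) div 2)))"
  have pos: "0 < letter c" for c using ab by (simp add: letter_def)
  have bnd: "0 \<le> cfrac (\<lambda>i. letter (u i))" "cfrac (\<lambda>i. letter (u i)) \<le> 1" for u :: "nat \<Rightarrow> int"
    using cfrac_bounds[of "\<lambda>i. letter (u i)"] pos by auto
  have Vh: "?V h = 1 / (real b + cfrac (\<lambda>i. letter (h ((2 * k + Suc i) div 2))))"
    using cfrac_unfold[of "\<lambda>i. letter (h ((2 * k + i) div 2))"] pos gh by (simp add: letter_def)
  have Vg: "?V g = 1 / (real a + cfrac (\<lambda>i. letter (g ((2 * k + Suc i) div 2))))"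
    using cfrac_unfold[of "\<lambda>i. letter (g ((2 * k + i) div 2))"] pos gh by (simp add: letter_def)
  have "?V h \<le> ?V g"
    unfolding Vh Vg
    using ab bnd[of "\<lambda>i. g ((2 * k + Suc i) div 2)"] bnd[of "\<lambda>i. h ((2 * k + Suc i) div 2)"]
    by (intro divide_left_mono) (auto intro!: mult_pos_pos add_pos_nonneg simp del: add_Suc_right)
  then have "cf_tail (2 * k) (?f h) (?V h) \<le> cf_tail (2 * k) (?f h) (?V g)"
    using pos bnd by (intro cf_tail_even_mono)
  also have "\<dots> = cf_tail (2 * k) (?f g) (?V g)"
    by (intro cf_tail_cong) (auto simp: eq)
  finally show ?thesis
    using cfrac_eq_cf_tail[of "?f h" "2 * k"] cfrac_eq_cf_tail[of "?f g" "2 * k"] pos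
    by (simp add: doubled_cf_def letter_def)
qed simp

section \<open>Mechanical words\<close>

lemma sum_G_forward: "(\<Sum>i<k. G x (n + 1 + int i)) = \<lfloor>of_int (n + int k) * x\<rfloor> - \<lfloor>of_int n * x\<rfloor>"
  by (induction k) (simp_all add: G_def algebra_simps)

lemma sum_G_backward: "(\<Sum>i<k. G x (n - 1 - int i)) = \<lfloor>of_int (n - 1) * x\<rfloor> - \<lfloor>of_int (n - 1 - int k) * x\<rfloor>"
  by (induction k) (simp_all add: G_def algebra_simps)

lemma floor_mult_superadditive:
  "\<lfloor>of_int m * (x::rat)\<rfloor> + \<lfloor>of_int n * x\<rfloor> \<le> \<lfloor>of_int (m + n) * x\<rfloor>"
  using le_floor_add[of "of_int m * x" "of_int n * x"] by (simp add: algebra_simps)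

text \<open>
  Every factor of length \<open>k\<close> has sum at least \<open>\<lfloor>kx\<rfloor>\<close>, which is the sum of the first \<open>k\<close> letters.
\<close>

lemma sum_G_forward_minimal:
  "(\<Sum>i<k. G x (0 + 1 + int i)) \<le> (\<Sum>i<k. G x (n + 1 + int i))"
  "(\<Sum>i<k. G x (0 + 1 + int i)) \<le> (\<Sum>i<k. G x (n - 1 - int i))"
  unfolding sum_G_forward sum_G_backward
  using floor_mult_superadditive[of n x "int k"] floor_mult_superadditive[of "n - 1 - int k" x "int k"]
  by simp_all

text \<open>
  A factor of length \<open>k + 1\<close> has sum at most \<open>\<lceil>(k + 1)x\<rceil>\<close>, and the factor that ends at 0 attains
  it. Removing the equal letters at \<open>n\<close> and at 0 gives the comparison.
\<close>

lemma sum_G_backward_maximal: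
  assumes "G x n = G x 0"
  shows "(\<Sum>i<k. G x (n + 1 + int i)) \<le> (\<Sum>i<k. G x (0 - 1 - int i))"
    and "(\<Sum>i<k. G x (n - 1 - int i)) \<le> (\<Sum>i<k. G x (0 - 1 - int i))"
proof -
  have n: "\<lfloor>of_int n * x\<rfloor> - \<lfloor>of_int (n - 1) * x\<rfloor> = - \<lfloor>of_int (0 - 1) * x\<rfloor>"
    using assms by (simp add: G_def)
  show "(\<Sum>i<k. G x (n + 1 + int i)) \<le> (\<Sum>i<k. G x (0 - 1 - int i))"
    unfolding sum_G_forward sum_G_backward
    using n floor_mult_superadditive[of "n + int k" x "0 - 1 - int k"]
    by (simp del: of_int_add of_int_diff)
  show "(\<Sum>i<k. G x (n - 1 - int i)) \<le> (\<Sum>i<k. G x (0 - 1 - int i))"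
    unfolding sum_G_backward
    using n floor_mult_superadditive[of n x "0 - 1 - int k"]
    by (simp add: add_diff_eq del: of_int_add of_int_diff)
qed

text \<open>
  The expansions read away from block \<open>n\<close>, to the right and to the left, without the block.
\<close>

definition forward_cf :: "nat \<Rightarrow> nat \<Rightarrow> rat \<Rightarrow> int \<Rightarrow> real" where
  "forward_cf a b x n = doubled_cf a b (\<lambda>i. G x (n + 1 + int i))"

definition backward_cf :: "nat \<Rightarrow> nat \<Rightarrow> rat \<Rightarrow> int \<Rightarrow> real" where
  "backward_cf a b x n = doubled_cf a b (\<lambda>i. G x (n - 1 - int i))"

lemma two_sided_pos: "0 < a \<Longrightarrow> a < b \<Longrightarrow> 0 < two_sided a b x i"
  by (simp add: two_sided_def)

lemma cfrac_two_sided: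
  "cfrac (\<lambda>k. two_sided a b x (2 * n + 1 + int k)) = forward_cf a b x n"
  "cfrac (\<lambda>k. two_sided a b x (2 * n - 2 - int k)) = backward_cf a b x n"
proof -
  have "(2 * n + 1 + int k + 1) div 2 = n + 1 + int (k div 2)"
    "(2 * n - 2 - int k + 1) div 2 = n - 1 - int (k div 2)" for k
    by presburger+
  then show "cfrac (\<lambda>k. two_sided a b x (2 * n + 1 + int k)) = forward_cf a b x n"
    "cfrac (\<lambda>k. two_sided a b x (2 * n - 2 - int k)) = backward_cf a b x n"
    by (simp_all only: two_sided_def forward_cf_def backward_cf_def doubled_cf_def)
qed

lemma two_sided_block_eq: "two_sided a b x (2 * n - 1) = two_sided a b x (2 * n)"
  by (simp add: two_sided_odd_even)

text \<open>
  The centre of \<open>L\<close> is either the right or the left entry of a block; the other entry of the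
  block is the first quotient of the expansion on its side.
\<close>

lemma L_at_block:
  fixes x :: rat
  assumes "0 < a" "a < b"
  defines "c \<equiv> \<lambda>n. real (two_sided a b x (2 * n))"
  shows "L a b x (2 * n + 1) = 1 / (c n + backward_cf a b x n) + c n + forward_cf a b x n"
    and "L a b x (2 * n) = backward_cf a b x n + c n + 1 / (c n + forward_cf a b x n)"
proof -
  note pos = two_sided_pos[OF assms(1,2)]
  have shift: "2 * n - 1 - int (Suc k) = 2 * n - 2 - int k" "2 * n + int (Suc k) = 2 * n + 1 + int k" for k
    by simp_all
  have "cfrac (\<lambda>k. two_sided a b x (2 * n - 1 - int k)) = 1 / (c n + backward_cf a b x n)"
    using cfrac_unfold[of "\<lambda>k. two_sided a b x (2 * n - 1 - int k)", OF pos]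
    unfolding shift cfrac_two_sided by (simp add: c_def two_sided_block_eq)
  then show "L a b x (2 * n + 1) = 1 / (c n + backward_cf a b x n) + c n + forward_cf a b x n"
    by (simp add: L_def c_def cfrac_two_sided)
  have "cfrac (\<lambda>k. two_sided a b x (2 * n + int k)) = 1 / (c n + forward_cf a b x n)"
    using cfrac_unfold[of "\<lambda>k. two_sided a b x (2 * n + int k)", OF pos]
    unfolding shift cfrac_two_sided by (simp add: c_def)
  then show "L a b x (2 * n) = backward_cf a b x n + c n + 1 / (c n + forward_cf a b x n)"
    by (simp add: L_def c_def cfrac_two_sided two_sided_block_eq)
qed

text \<open>
  Block 0 maximises \<open>c + 1 / (c + u) + v\<close>: when the letters agree, it has the least \<open>u\<close> and the
  greatest \<open>v\<close>; when they differ, its letter is \<open>b\<close> and exceeds \<open>c = a\<close> by at least 1.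
\<close>

lemma L_le_L_1:
  assumes ab: "0 < a" "a < b" and x: "0 \<le> x" "x \<le> 1"
  shows "L a b x m \<le> L a b x 1"
proof -
  define F where "F = forward_cf a b x"
  define B where "B = backward_cf a b x"
  define c where "c n = real (two_sided a b x (2 * n))" for n
  have FB0: "0 \<le> F n" "0 \<le> B n" for n
    using doubled_cf_bounds[OF ab] by (simp_all add: F_def B_def forward_cf_def backward_cf_def)
  have c1: "1 \<le> c n" for n using two_sided_pos[OF ab, of x "2 * n"] by (simp add: c_def)
  note antimono = doubled_cf_antimono[OF ab G_cases[OF x] G_cases[OF x]]
  have maximal: "F n \<le> F 0" "B n \<le> F 0" for n
    unfolding F_def B_def forward_cf_def backward_cf_def
    by (intro antimono sum_G_forward_minimal)+
  have minimal: "B 0 \<le> F n" "B 0 \<le> B n" if "G x n = G x 0" for n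
    unfolding F_def B_def forward_cf_def backward_cf_def
    by (intro antimono sum_G_backward_maximal that)+
  have bound: "1 / (c n + u) + c n + v \<le> 1 / (c 0 + B 0) + c 0 + F 0"
    if uv: "0 \<le> u" "v \<le> F 0" and u: "G x n = G x 0 \<Longrightarrow> B 0 \<le> u" for n u v
  proof (cases "G x n = G x 0")
    case True
    then have "c n = c 0" unfolding c_def two_sided_odd_even(2) by simp
    moreover have "1 / (c 0 + u) \<le> 1 / (c 0 + B 0)"
      using u[OF True] FB0[of 0] c1[of 0] uv by (intro divide_left_mono) auto
    ultimately show ?thesis using uv by simp
  next
    case False
    \<comment> \<open>A letter 0 at block 0 forces \<open>x = 0\<close>, and then the word is constant.\<close>
    have "G x 0 \<noteq> 0"
    proof
      assume "G x 0 = 0"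
      then have "\<lfloor>- x\<rfloor> = 0" by (simp add: G_def)
      then have "x = 0" using x by linarith
      then have "G x n = G x 0" by (simp add: G_def)
      with False show False ..
    qed
    with False have "G x n = 0" using G_cases[OF x, of n] G_cases[OF x, of 0] by auto
    with \<open>G x 0 \<noteq> 0\<close> have "c n = a" "c 0 = b"
      using two_sided_odd_even(2)[of a b x n] two_sided_odd_even(2)[of a b x 0] by (simp_all add: c_def)
    then have "c n + 1 \<le> c 0" using ab by simp
    moreover have "1 / (c n + u) \<le> 1" using c1[of n] uv by simp
    moreover have "0 \<le> 1 / (c 0 + B 0)" using c1[of 0] FB0[of 0] by simp
    ultimately show ?thesis using uv by linarith
  qed
  have L1: "L a b x 1 = 1 / (c 0 + B 0) + c 0 + F 0"
    using L_at_block(1)[OF ab, of x 0] by (simp add: c_def F_def B_def)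
  show ?thesis
  proof (cases "even m")
    case True
    then obtain n where m: "m = 2 * n" by blast
    have "L a b x m = 1 / (c n + F n) + c n + B n"
      using L_at_block(2)[OF ab, of x n] by (simp add: m c_def F_def B_def)
    then show ?thesis unfolding L1 using bound[of "F n" "B n" n] FB0 maximal minimal by simp
  next
    case False
    then obtain n where m: "m = 2 * n + 1" by (rule oddE)
    have "L a b x m = 1 / (c n + B n) + c n + F n"
      using L_at_block(1)[OF ab, of x n] by (simp add: m c_def F_def B_def)
    then show ?thesis unfolding L1 using bound[of "B n" "F n" n] FB0 maximal minimal by simp
  qed
qed

section \<open>Periodicity\<close>

lemma G_periodic:
  fixes d p :: int
  assumes "of_int d * x = of_int p"
  shows "G x (n + d * j) = G x n"
proof -
  have "of_int (m + d * j) * x = of_int m * x + of_int (p * j)" for m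
    using assms by (simp add: algebra_simps)
  then have "\<lfloor>of_int (m + d * j) * x\<rfloor> = \<lfloor>of_int m * x\<rfloor> + p * j" for m
    by (simp only: floor_add_int)
  from this[of n] this[of "n - 1"] show ?thesis
    by (simp add: G_def algebra_simps del: of_int_add of_int_diff)
qed

lemma L_periodic:
  fixes d p :: int
  assumes "of_int d * x = of_int p"
  shows "L a b x (n + 2 * (d * j)) = L a b x n"
proof -
  have "two_sided a b x (i + 2 * (d * j)) = two_sided a b x i" for i
  proof -
    have "(i + 2 * (d * j) + 1) div 2 = (i + 1) div 2 + d * j" by presburger
    then show ?thesis by (simp add: two_sided_def G_periodic[OF assms])
  qed
  note per = this
  have "two_sided a b x (n + 2 * (d * j) - 2 - int k) = two_sided a b x (n - 2 - int k)"
    "two_sided a b x (n + 2 * (d * j) - 1) = two_sided a b x (n - 1)"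
    "two_sided a b x (n + 2 * (d * j) + int k) = two_sided a b x (n + int k)" for k
    using per[of "n - 2 - int k"] per[of "n - 1"] per[of "n + int k"] by (simp_all add: algebra_simps)
  then show ?thesis by (simp add: L_def)
qed

text \<open>
  The centre \<open>f n\<close> has index \<open>n + 1\<close> in the two-sided sequence, and \<open>L(x, m)\<close> is centred at \<open>m - 1\<close>;
  hence \<open>m = n + 2\<close>. Only the left expansion differs, being cut off after \<open>n\<close> quotients.
\<close>

lemma perron_quantity_near_L:
  fixes x :: rat
  assumes ab: "0 < a" "a < b"
  defines "f \<equiv> \<lambda>k. two_sided a b x (1 + int k)"
  shows "\<bar>real (f n) + cfrac (\<lambda>k. f (Suc n + k)) + cf_tail n (\<lambda>k. f (n - Suc k)) 0
      - L a b x (int n + 2)\<bar> \<le> (1/4) ^ (n div 2)"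
proof -
  have "cf_tail n (\<lambda>k. f (n - Suc k)) 0 = cf_tail n (\<lambda>k. two_sided a b x (int n - int k)) 0"
    by (rule cf_tail_cong) (simp add: f_def of_nat_diff)
  moreover have "(\<lambda>k. f (Suc n + k)) = (\<lambda>k. two_sided a b x (int n + 2 + int k))"
    by (simp add: f_def algebra_simps)
  ultimately show ?thesis
    using cfrac_approx[of "\<lambda>k. two_sided a b x (int n - int k)" n] two_sided_pos[OF ab]
    by (simp add: L_def f_def algebra_simps)
qed

theorem theorem3p5:
  fixes a b :: nat and x :: rat
  assumes "0 < a" and "a < b" and "0 \<le> x" and "x \<le> 1"
  shows "lagrange_const (cf_value (phi a b (G_word x))) = ereal (L a b x 1)"
proof -
  define f where "f k = two_sided a b x (1 + int k)" for k
  define M where "M n = real (f n) + cfrac (\<lambda>k. f (Suc n + k)) + cf_tail n (\<lambda>k. f (n - Suc k)) 0" for n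
  have near: "\<bar>M n - L a b x (int n + 2)\<bar> \<le> (1/4) ^ (n div 2)" for n
    using perron_quantity_near_L[OF assms(1,2), of x n] by (simp add: M_def f_def)
  have "0 < f k" for k unfolding f_def by (rule two_sided_pos[OF assms(1,2)])
  then have "lagrange_const (cfrac f) = limsup (\<lambda>n. ereal (M n))"
    unfolding M_def by (rule lagrange_const_cfrac)
  also have "\<dots> = ereal (L a b x 1)"
  proof (rule antisym)
    have "M n \<le> L a b x 1 + (1/4) ^ (n div 2)" for n
      using near[of n] L_le_L_1[OF assms, of "int n + 2"] by linarith
    then have "limsup (\<lambda>n. ereal (M n)) \<le> limsup (\<lambda>n. ereal (L a b x 1 + (1/4) ^ (n div 2)))"
      by (intro Limsup_mono always_eventually) simp
    also have "\<dots> = ereal (L a b x 1)"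
      using tendsto_add[OF tendsto_const quarter_power_tendsto_0]
      by (intro lim_imp_Limsup) (auto intro!: tendsto_eq_intros quarter_power_tendsto_0)
    finally show "limsup (\<lambda>n. ereal (M n)) \<le> ereal (L a b x 1)" .
  next
    obtain p d :: int where d: "0 < d" "of_int d * x = of_int p"
    proof -
      obtain p d where "quotient_of x = (p, d)" by fastforce
      with quotient_of_denom_pos[OF this] quotient_of_div[OF this] that[of d p] show ?thesis by simp
    qed
    \<comment> \<open>These indices satisfy \<open>r j + 2 = 1 + 2d(j + 1)\<close>, a shift of 1 by whole periods \<open>2d\<close>.\<close>
    define r where "r j = nat (2 * (d * (int j + 1)) - 1)" for j :: nat
    have int_r: "int (r j) = 2 * (d * (int j + 1)) - 1" for j
    proof -
      have "0 < d * (int j + 1)" using d(1) by simp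
      then show ?thesis by (simp add: r_def)
    qed
    have r: "strict_mono r"
    proof (rule strict_monoI_Suc)
      fix j
      have "int (r j) < int (r (Suc j))" using d(1) unfolding int_r by (simp add: algebra_simps)
      then show "r j < r (Suc j)" by simp
    qed
    have "int (r j) + 2 = 1 + 2 * (d * (int j + 1))" for j by (simp add: int_r)
    then have "norm (M (r j) - L a b x 1) \<le> (1/4) ^ (r j div 2)" for j
      using near[of "r j"] by (simp only: L_periodic[OF d(2)] real_norm_def)
    then have "\<forall>\<^sub>F j in sequentially. norm (M (r j) - L a b x 1) \<le> (1/4) ^ (r j div 2)"
      by (rule eventuallyI)
    moreover have "(\<lambda>j. (1/4::real) ^ (r j div 2)) \<longlonglongrightarrow> 0"
      using LIMSEQ_subseq_LIMSEQ[OF quarter_power_tendsto_0 r] by (simp only: o_def)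
    ultimately have "(\<lambda>j. M (r j) - L a b x 1) \<longlonglongrightarrow> 0"
      by (rule Lim_null_comparison)
    then have "(\<lambda>j. ereal (M (r j))) \<longlonglongrightarrow> ereal (L a b x 1)"
      by (simp add: LIM_zero_iff)
    then have "ereal (L a b x 1) = limsup ((\<lambda>n. ereal (M n)) \<circ> r)"
      unfolding o_def by (intro lim_imp_Limsup[symmetric]) simp_all
    also have "\<dots> \<le> limsup (\<lambda>n. ereal (M n))" by (rule limsup_subseq_mono[OF r])
    finally show "ereal (L a b x 1) \<le> limsup (\<lambda>n. ereal (M n))" .
  qed
  finally show ?thesis by (simp add: phi_eq_two_sided f_def[abs_def])
qed

end
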